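(* Let $k\ge 3$ be an integer, let $\varepsilon^*\in\{0,1\}$ be the remainder of $k$ upon division by $2$, let $n$ be an integer, and let $\varepsilon\in\{0,1\}$ be the remainder of $n$ upon division by $2$. If $n\ge 3k+3+\varepsilon(2\varepsilon^*-1)$, then there exists a $(C_4,K_{1,k})$-co-critical graph $G$ on $n$ vertices such that \[ e(G)=\begin{cases}\dfrac{(k+2)n}{2}-\dfrac{(2+\varepsilon)k-4\varepsilon}{2} & \text{if } k \text{ is odd},\\[2mm] \dfrac{(k+2)n}{2}-\dfrac{(2-\varepsilon)k-2(1-2\varepsilon)}{2} & \text{if } k \text{ is even}.\end{cases} \]
   Context: All graphs are finite, simple, without loops or multiple edges; $e(G)$ denotes the number of edges of $G$. For a graph $G$, a $\{\text{red},\text{blue}\}$-coloring of $E(G)$ is a critical coloring if $G$ contains neither a red copy of $C_4$ (the cycle on 4 vertices, as a not necessarily induced subgraph) nor a blue copy of $K_{1,k}$ (the star with $k$ leaves). A non-complete graph $G$ is $(C_4,K_{1,k})$-co-critical if $G$ admits a critical coloring, but for every edge $e$ of the complement of $G$, the graph $G+e$ (obtained by adding $e$) admits no critical coloring. *)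

theory Defs
  imports Complex_Main
begin

record 'a ugraph =
  verts :: "'a set"
  edges :: "'a set set"

definition all_pairs :: "'a set \<Rightarrow> 'a set set" where
  "all_pairs V = {e. e \<subseteq> V \<and> card e = 2}"

definition simple_graph :: "'a ugraph \<Rightarrow> bool" where
  "simple_graph G \<longleftrightarrow> finite (verts G) \<and> edges G \<subseteq> all_pairs (verts G)"

definition complete_graph :: "'a ugraph \<Rightarrow> bool" where
  "complete_graph G \<longleftrightarrow> simple_graph G \<and> edges G = all_pairs (verts G)"

definition complement_graph :: "'a ugraph \<Rightarrow> 'a ugraph" where
  "complement_graph G = \<lparr>verts = verts G, edges = all_pairs (verts G) - edges G\<rparr>"

definition add_edge :: "'a ugraph \<Rightarrow> 'a set \<Rightarrow> 'a ugraph" where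
  "add_edge G e = \<lparr>verts = verts G, edges = insert e (edges G)\<rparr>"

text \<open>A copy of \<open>H\<close> in \<open>G\<close> is a not necessarily induced subgraph of \<open>G\<close> isomorphic to \<open>H\<close>,
  presented by its embedding \<open>f\<close>.\<close>

definition contains_copy :: "'a ugraph \<Rightarrow> 'b ugraph \<Rightarrow> bool" where
  "contains_copy G H \<longleftrightarrow>
     (\<exists>f. inj_on f (verts H) \<and> f ` verts H \<subseteq> verts G \<and> (\<forall>e \<in> edges H. f ` e \<in> edges G))"

definition cycle4 :: "nat ugraph" where
  "cycle4 = \<lparr>verts = {0, 1, 2, 3}, edges = {{0, 1}, {1, 2}, {2, 3}, {3, 0}}\<rparr>"

definition star :: "nat \<Rightarrow> nat ugraph" where
  "star k = \<lparr>verts = {0..k}, edges = {{0, i} | i. i \<in> {1..k}}\<rparr>"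

datatype colour = Red | Blue

text \<open>A colouring is a total function on sets of vertices; only its values on \<open>edges G\<close> matter.\<close>

definition colour_class :: "'a ugraph \<Rightarrow> ('a set \<Rightarrow> colour) \<Rightarrow> colour \<Rightarrow> 'a ugraph" where
  "colour_class G c x = \<lparr>verts = verts G, edges = {e \<in> edges G. c e = x}\<rparr>"

definition critical_colouring :: "nat \<Rightarrow> 'a ugraph \<Rightarrow> ('a set \<Rightarrow> colour) \<Rightarrow> bool" where
  "critical_colouring k G c \<longleftrightarrow>
     \<not> contains_copy (colour_class G c Red) cycle4 \<and>
     \<not> contains_copy (colour_class G c Blue) (star k)"

definition co_critical :: "nat \<Rightarrow> 'a ugraph \<Rightarrow> bool" where
  "co_critical k G \<longleftrightarrow>
     simple_graph G \<and> \<not> complete_graph G \<and>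
     (\<exists>c. critical_colouring k G c) \<and>
     (\<forall>e \<in> edges (complement_graph G). \<not> (\<exists>c. critical_colouring k (add_edge G e) c))"

end

theory Submission
  imports Defs
begin

text \<open>
  Suppose \<open>x\<close> is adjacent to all other vertices, \<open>y\<close> has degree at least \<open>2k\<close>, and fix a critical
  colouring. Fewer than \<open>k\<close> edges at \<open>x\<close> are blue, and outside \<open>x\<close> every vertex has at most one
  red neighbour among the red neighbours of \<open>x\<close>. Hence \<open>y\<close>, which has at least \<open>k + 1\<close> red neighbours,
  must be red to \<open>x\<close> and to exactly \<open>k - 1\<close> blue neighbours of \<open>x\<close>, that is, to all of them. Now the
  absence of a red \<open>C\<^sub>4\<close> through \<open>x\<close> or \<open>y\<close> leaves every other vertex at most two red neighbours,
  so degree at most \<open>k + 1\<close>, and \<open>y\<close> has degree exactly \<open>2k\<close>. Therefore a graph with such \<open>x\<close> and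
  \<open>y\<close>, whose remaining degrees are at most \<open>k + 1\<close> and whose vertices of degree at most \<open>k\<close> form
  a clique, admits no critical colouring after an edge is added.

  In the graphs constructed here the red edges join \<open>x\<close> to the complement of a set \<open>B\<close> of \<open>k - 1\<close>
  neighbours of \<open>y\<close>, join \<open>y\<close> to \<open>B\<close>, and form a matching inside \<open>B\<close> and inside its complement.
  The blue edges are essentially a \<open>(k - 1)\<close>-regular circulant graph; up to three extra
  vertices adjust the parities and the number of edges.
\<close>

section \<open>Neighbourhoods and the forbidden subgraphs\<close>

text \<open>Taken relative to a bare edge set, so that one notion serves graphs, their colour
  classes and edge sets grown by insertion.\<close>

definition nbrs :: "'a set set \<Rightarrow> 'a \<Rightarrow> 'a set" where
  "nbrs E v = {u. {u, v} \<in> E}"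

lemma nbrs_sym: "u \<in> nbrs E v \<longleftrightarrow> v \<in> nbrs E u"
  by (simp add: nbrs_def insert_commute)

lemma nbrs_subset:
  assumes "E \<subseteq> all_pairs V"
  shows "nbrs E v \<subseteq> V - {v}"
  using assms by (auto simp: nbrs_def all_pairs_def)

text \<open>Only opposite vertices of the cycle have to be assumed distinct: adjacent ones differ
  because \<open>F\<close> has no loops.\<close>

lemma contains_cycle4_iff:
  assumes "F \<subseteq> all_pairs V"
  shows "contains_copy \<lparr>verts = V, edges = F\<rparr> cycle4 \<longleftrightarrow>
    (\<exists>a b c d. a \<noteq> c \<and> b \<noteq> d \<and> b \<in> nbrs F a \<and> b \<in> nbrs F c \<and> d \<in> nbrs F a \<and> d \<in> nbrs F c)"
    (is "?L \<longleftrightarrow> ?R")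
proof
  assume ?L
  then obtain f :: "nat \<Rightarrow> 'a" where f: "inj_on f {0,1,2,3}"
    and e: "{f 0, f 1} \<in> F" "{f 1, f 2} \<in> F" "{f 2, f 3} \<in> F" "{f 3, f 0} \<in> F"
    by (auto simp: contains_copy_def cycle4_def)
  have "f 0 \<noteq> f 2" "f 1 \<noteq> f 3"
    using inj_onD[OF f, of 0 2] inj_onD[OF f, of 1 3] by auto
  with e show ?R
    by (intro exI[of _ "f 0"] exI[of _ "f 1"] exI[of _ "f 2"] exI[of _ "f 3"])
      (simp add: nbrs_def insert_commute)
next
  assume ?R
  then obtain a b c d where *: "a \<noteq> c" "b \<noteq> d"
    "b \<in> nbrs F a" "b \<in> nbrs F c" "d \<in> nbrs F a" "d \<in> nbrs F c" by blast
  \<comment> \<open>The default value \<open>d\<close> is the image of 3.\<close>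
  define f :: "nat \<Rightarrow> 'a" where "f = (\<lambda>_. d)(0 := a, 1 := b, 2 := c)"
  have f: "f 0 = a" "f 1 = b" "f 2 = c" "f 3 = d" "f (Suc 0) = b" by (simp_all add: f_def)
  have V: "a \<in> V" "b \<in> V" "c \<in> V" "d \<in> V" and d: "a \<noteq> b" "b \<noteq> c" "c \<noteq> d" "a \<noteq> d"
    using *(3-) nbrs_subset[OF assms] by (metis DiffD1 DiffD2 nbrs_sym singletonI subsetD)+
  have "inj_on f {0, 1, 2, 3}"
    using * d by (auto simp: inj_on_def f)
  moreover have "{a, b} \<in> F" "{b, c} \<in> F" "{c, d} \<in> F" "{d, a} \<in> F"
    using *(3-) by (simp_all add: nbrs_def insert_commute)
  ultimately show ?L
    unfolding contains_copy_def cycle4_def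
    using V by (auto simp only: f ugraph.simps image_insert image_empty intro!: exI[of _ f])
qed

text \<open>For \<open>k = 0\<close> the right side would hold even over an empty \<open>V\<close>.
  A positive \<open>k\<close> gives \<open>v\<close> a neighbour, which places the centre in
  \<open>V\<close>.\<close>

lemma contains_star_iff:
  assumes "F \<subseteq> all_pairs V" and "finite V" and "k > 0"
  shows "contains_copy \<lparr>verts = V, edges = F\<rparr> (star k) \<longleftrightarrow> (\<exists>v. card (nbrs F v) \<ge> k)"
    (is "?L \<longleftrightarrow> ?R")
proof
  assume ?L
  then obtain f where f: "inj_on f {0..k}"
    and f_edges: "\<forall>e \<in> {{0, i} | i. i \<in> {1..k}}. f ` e \<in> F"
    by (auto simp: contains_copy_def star_def)
  have "\<And>i. i \<in> {1..k} \<Longrightarrow> f ` {0, i} \<in> F"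
    using f_edges by (metis (mono_tags, lifting) mem_Collect_eq)
  then have e: "\<And>i. i \<in> {1..k} \<Longrightarrow> {f 0, f i} \<in> F" by simp
  have "f ` {1..k} \<subseteq> nbrs F (f 0)"
    using e by (auto simp: nbrs_def insert_commute)
  moreover have "inj_on f {1..k}"
    using f by (rule inj_on_subset) auto
  moreover have "finite (nbrs F (f 0))"
    using nbrs_subset[OF assms(1)] assms(2) finite_subset by blast
  ultimately have "card {1..k} \<le> card (nbrs F (f 0))"
    by (metis card_image card_mono)
  then show ?R by auto
next
  assume ?R
  then obtain v S where S: "S \<subseteq> nbrs F v" "card S = k"
    by (meson obtain_subset_with_card_n)
  have sub: "S \<subseteq> V - {v}" using S nbrs_subset[OF assms(1)] by blast
  then have "finite S" using assms(2) finite_subset by blast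
  then obtain g where g: "bij_betw g {1..k} S"
    using S(2) by (metis card_atLeastAtMost diff_Suc_1 finite_atLeastAtMost finite_same_card_bij)
  have "S \<noteq> {}" using S(2) assms(3) by auto
  then have v: "v \<in> V" using S(1) nbrs_subset[OF assms(1)]
    by (metis DiffD1 nbrs_sym ex_in_conv subsetD)
  define f where "f = g(0 := v)"
  have fg: "f i = g i" "g i \<in> S" if "i \<in> {1..k}" for i
    using that g by (auto simp: f_def bij_betw_def)
  have img: "f ` {1..k} = S" using g fg by (auto simp: bij_betw_def)
  have inj: "inj_on f {1..k}" using g fg(1) by (metis bij_betw_def inj_on_cong)
  have dec: "{0..k} = insert 0 {1..k}" by auto
  have "inj_on f {0..k}"
    unfolding dec inj_on_insert using inj img sub by (auto simp: f_def)
  moreover have "f ` {0..k} \<subseteq> V" unfolding dec using img sub v by (auto simp: f_def)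
  moreover have "{f 0, f i} \<in> F" if "i \<in> {1..k}" for i
    using that fg[OF that] S(1) by (auto simp: f_def nbrs_def insert_commute)
  ultimately show ?L
    unfolding contains_copy_def star_def ugraph.simps by (intro exI[of _ f]) force
qed

text \<open>As a rewrite rule this computes degrees in a listed edge set, one inserted edge at a
  time.\<close>

lemma card_nbrs_insert:
  assumes "a \<noteq> b" and "{a, b} \<notin> E" and "finite (nbrs E v)"
  shows "card (nbrs (insert {a, b} E) v) = card (nbrs E v) + of_bool (v = a \<or> v = b)"
proof -
  have "nbrs (insert {a, b} E) v =
    (if v = a then insert b (nbrs E v) else if v = b then insert a (nbrs E v) else nbrs E v)"
    using assms(1) by (auto simp: nbrs_def doubleton_eq_iff)
  moreover have "v = a \<Longrightarrow> b \<notin> nbrs E v" "v = b \<Longrightarrow> a \<notin> nbrs E v"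
    using assms(2) by (auto simp: nbrs_def insert_commute)
  ultimately show ?thesis using assms(1,3) by auto
qed

lemma finite_nbrs_insert: "finite (nbrs E v) \<Longrightarrow> finite (nbrs (insert {a, b} E) v)"
  by (rule finite_subset[of _ "insert a (insert b (nbrs E v))"]) (auto simp: nbrs_def doubleton_eq_iff)

lemma handshake:
  assumes "finite V" and "E \<subseteq> all_pairs V"
  shows "(\<Sum>v\<in>V. card (nbrs E v)) = 2 * card E"
proof -
  have finE: "finite E"
    using assms by (auto simp: all_pairs_def intro: finite_subset[of E "Pow V"])
  have inc: "card (nbrs E v) = card {e \<in> E. v \<in> e}" for v
  proof (rule bij_betw_same_card)
    have "\<exists>u. {u, v} \<in> E \<and> e = {u, v}" if "e \<in> E" "v \<in> e" for e
    proof -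
      have "card e = 2" using that assms by (auto simp: all_pairs_def)
      then obtain p q where "e = {p, q}" by (auto simp: card_2_iff)
      with that show ?thesis by (auto simp: insert_commute)
    qed
    then show "bij_betw (\<lambda>u. {u, v}) (nbrs E v) {e \<in> E. v \<in> e}"
      by (fastforce simp: bij_betw_def inj_on_def nbrs_def doubleton_eq_iff)
  qed
  have "(\<Sum>v\<in>V. card {e \<in> E. v \<in> e}) = (\<Sum>e\<in>E. 2)"
  proof (rule sum_multicount_gen[OF assms(1) finE], intro ballI)
    fix e assume "e \<in> E"
    then have "e \<subseteq> V" "card e = 2" using assms by (auto simp: all_pairs_def)
    then show "card {v \<in> V. v \<in> e} = 2" by (metis Collect_mem_eq Int_absorb1 Int_def)
  qed
  then show ?thesis by (simp add: inc)
qed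

text \<open>Removes embeddings from the notion: the arguments below only count common red neighbours
  and blue degrees.\<close>

lemma critical_colouring_iff:
  assumes "F \<subseteq> all_pairs V" and "finite V" and "k > 0"
  shows "critical_colouring k \<lparr>verts = V, edges = F\<rparr> c \<longleftrightarrow>
    (\<forall>u v p q. u \<noteq> v \<longrightarrow> p \<in> nbrs {e \<in> F. c e = Red} u \<inter> nbrs {e \<in> F. c e = Red} v \<longrightarrow>
       q \<in> nbrs {e \<in> F. c e = Red} u \<inter> nbrs {e \<in> F. c e = Red} v \<longrightarrow> p = q) \<and>
    (\<forall>v. card (nbrs {e \<in> F. c e = Blue} v) < k)"
proof -
  have sub: "{e \<in> F. c e = x} \<subseteq> all_pairs V" for x using assms(1) by blast
  show ?thesis
    unfolding critical_colouring_def colour_class_def ugraph.simps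
      contains_cycle4_iff[OF sub] contains_star_iff[OF sub assms(2,3)]
    by (auto simp: not_le)
qed

section \<open>Degrees forced by a critical colouring with two hubs\<close>

text \<open>Since \<open>r x\<close> and \<open>b x\<close> cover all vertices except
  \<open>x\<close>, a red neighbourhood splits into a part of \<open>{x}\<close>, at most one vertex
  of \<open>r x\<close>, and a part of \<open>b x\<close>. The large degree of \<open>y\<close>
  exhausts these bounds.\<close>

lemma critical_colouring_degrees:
  assumes F: "F \<subseteq> all_pairs V" and fin: "finite V" and k: "k > 0"
    and crit: "critical_colouring k \<lparr>verts = V, edges = F\<rparr> c"
    and x: "x \<in> V" "\<And>v. v \<in> V \<Longrightarrow> v \<noteq> x \<Longrightarrow> {x, v} \<in> F"
    and y: "y \<in> V" "y \<noteq> x" "card (nbrs F y) \<ge> 2 * k"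
  shows "card (nbrs F y) = 2 * k"
    and "\<And>v. v \<in> V \<Longrightarrow> v \<noteq> x \<Longrightarrow> v \<noteq> y \<Longrightarrow> card (nbrs F v) \<le> k + 1"
proof -
  define r where "r = nbrs {e \<in> F. c e = Red}"
  define b where "b = nbrs {e \<in> F. c e = Blue}"
  have C4: "p = q" if "u \<noteq> v" "p \<in> r u \<inter> r v" "q \<in> r u \<inter> r v" for u v p q
    using crit that unfolding critical_colouring_iff[OF F fin k] r_def by blast
  have star: "card (b v) < k" for v
    using crit unfolding critical_colouring_iff[OF F fin k] b_def by blast
  have union: "nbrs F v = r v \<union> b v" for v
    by (auto simp: r_def b_def nbrs_def) (metis colour.exhaust)
  have disj: "r v \<inter> b v = {}" for v
    by (auto simp: r_def b_def nbrs_def)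
  have subV: "r v \<union> b v \<subseteq> V - {v}" for v
    using nbrs_subset[OF F] union by metis
  then have finrb: "finite (r v)" "finite (b v)" for v
    using fin by (meson Diff_subset finite_subset le_sup_iff)+
  have sym: "u \<in> r v \<longleftrightarrow> v \<in> r u" for u v
    unfolding r_def by (rule nbrs_sym)
  have deg: "card (nbrs F v) = card (r v) + card (b v)" for v
    unfolding union by (rule card_Un_disjoint[OF finrb disj])
  have rx: "r x \<union> b x = V - {x}"
    using x(2) union[of x] nbrs_subset[OF F, of x] by (auto simp: nbrs_def insert_commute)
  have common: "card (r u \<inter> r v) \<le> 1" if "u \<noteq> v" for u v
    using C4[OF that] finrb by (simp add: card_le_Suc0_iff_eq)
  have ry: "card (r y) \<ge> k + 1" using y(3) deg[of y] star[of y] by simp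
  \<comment> \<open>Otherwise \<open>y\<close> occupies one of the at most \<open>k - 1\<close>
    places in \<open>b x\<close>, leaving at most \<open>k - 1\<close> red neighbours for
    \<open>y\<close>, fewer than \<open>k + 1\<close>.\<close>
  have y_red: "y \<in> r x"
  proof (rule ccontr)
    assume "y \<notin> r x"
    then have yb: "y \<in> b x" using rx y by blast
    have "x \<notin> r y" using \<open>y \<notin> r x\<close> sym by blast
    then have "r y \<subseteq> (r y \<inter> r x) \<union> (b x - {y})" using subV[of y] rx by blast
    then have "card (r y) \<le> card (r y \<inter> r x) + card (b x - {y})"
      by (meson card_Un_le card_mono finite_Diff finite_Int finite_UnI finrb order_trans)
    also have "\<dots> \<le> 1 + (card (b x) - 1)"
      using common[OF y(2)] yb finrb by (simp add: card_Diff_singleton)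
    finally show False using ry star[of x] by linarith
  qed
  have split: "card (r v) \<le> card (r v \<inter> {x}) + card (r v \<inter> r x) + card (r v \<inter> b x)" for v
  proof -
    have "r v = (r v \<inter> {x}) \<union> (r v \<inter> r x) \<union> (r v \<inter> b x)"
      using subV[of v] rx by blast
    then show ?thesis using card_Un_le[of "(r v \<inter> {x}) \<union> (r v \<inter> r x)" "r v \<inter> b x"]
        card_Un_le[of "r v \<inter> {x}" "r v \<inter> r x"] by simp
  qed
  have leaf: "card (r v \<inter> {x}) \<le> 1" for v
    by (rule order_trans[OF card_mono[of "{x}"]]) auto
  \<comment> \<open>At least \<open>k + 1\<close> red neighbours, of which at most one is
    \<open>x\<close> and at most one lies in \<open>r x\<close>.\<close>
  have "card (r y \<inter> b x) \<ge> k - 1"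
    using split[of y] leaf[of y] common[OF y(2)] ry by linarith
  then have "r y \<inter> b x = b x"
    using star[of x] finrb by (intro card_seteq) auto
  then have b_sub: "b x \<subseteq> r y" by blast
  have "card (r y) \<le> 1 + 1 + (k - 1)"
    using split[of y] leaf[of y] common[OF y(2)] \<open>r y \<inter> b x = b x\<close> star[of x] by simp
  then show "card (nbrs F y) = 2 * k" using deg[of y] star[of y] y(3) by linarith
  fix v assume v: "v \<in> V" "v \<noteq> x" "v \<noteq> y"
  \<comment> \<open>A red neighbour of \<open>v\<close> in \<open>b x\<close> is shared with
    \<open>y\<close>. If \<open>v\<close> is blue to \<open>x\<close>, there is at most one such
    neighbour and \<open>x\<close> does not count; otherwise \<open>x\<close> is already shared with
    \<open>y\<close>, so there is none.\<close>
  have "card (r v) \<le> 2"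
  proof (cases "v \<in> b x")
    case True
    then have "r v \<inter> {x} = {}" using disj[of x] sym by blast
    moreover have "card (r v \<inter> b x) \<le> card (r v \<inter> r y)"
      using b_sub finrb by (intro card_mono) auto
    ultimately show ?thesis using split[of v] common[OF v(2)] common[OF v(3)] by simp
  next
    case False
    then have "x \<in> r v" using rx v sym by blast
    moreover have "x \<in> r y" using y_red sym by blast
    moreover have "x \<notin> b x" using subV by blast
    ultimately have "r v \<inter> b x = {}" using C4[OF v(3)] b_sub by blast
    then show ?thesis using split[of v] leaf[of v] common[OF v(2)] by simp
  qed
  then show "card (nbrs F v) \<le> k + 1" using deg[of v] star[of v] by linarith
qed

section \<open>A critical colouring and a criterion for co-criticality\<close>

text \<open>The involution \<open>m\<close> encodes the red matching, its fixed points being the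
  unmatched vertices. Away from the hubs the red degree is 2, or 1 at a fixed point, which explains
  the two degree bounds. Invariance of \<open>B\<close> keeps matching edges from linking the two
  red stars.\<close>

lemma critical_colouring_hubs:
  assumes E: "E \<subseteq> all_pairs V" and fin: "finite V" and k: "k > 0"
    and x: "x \<in> V" "\<And>v. v \<in> V \<Longrightarrow> v \<noteq> x \<Longrightarrow> {x, v} \<in> E"
    and y: "y \<in> V" "y \<noteq> x" "card (nbrs E y) \<le> 2 * k"
    and B: "B \<subseteq> V - {x, y}" "card B = k - 1" "\<And>v. v \<in> B \<Longrightarrow> {y, v} \<in> E"
    and m: "\<And>v. v \<in> V \<Longrightarrow> m v \<in> V" "\<And>v. v \<in> V \<Longrightarrow> m (m v) = v" "\<And>v. v \<in> B \<Longrightarrow> m v \<in> B"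
      "m x = x" "m y \<noteq> y" "\<And>v. v \<in> V \<Longrightarrow> m v \<noteq> v \<Longrightarrow> {v, m v} \<in> E"
    and deg: "\<And>v. v \<in> V \<Longrightarrow> v \<noteq> x \<Longrightarrow> v \<noteq> y \<Longrightarrow> card (nbrs E v) \<le> (if m v = v then k else k + 1)"
  shows "\<exists>c. critical_colouring k \<lparr>verts = V, edges = E\<rparr> c"
proof -
  define S where "S = {{x, v} | v. v \<in> V - {x} - B} \<union> {{y, v} | v. v \<in> B} \<union>
    {{v, m v} | v. v \<in> V \<and> m v \<noteq> v}"
  define c where "c = (\<lambda>e. if e \<in> S then Red else Blue)"
  have SE: "S \<subseteq> E" using x B m by (auto simp: S_def)
  have nb: "nbrs E v \<subseteq> V - {v}" for v using nbrs_subset[OF E] .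
  have finn: "finite (nbrs E v)" for v using fin nb finite_subset by blast
  have red: "nbrs {e \<in> E. c e = Red} v = nbrs S v" for v
    using SE by (auto simp: c_def nbrs_def)
  have blue: "nbrs {e \<in> E. c e = Blue} v = nbrs E v - nbrs S v" for v
    by (auto simp: c_def nbrs_def)
  have mx: "m v \<noteq> x" if "v \<in> V" "v \<noteq> x" for v using m that by metis
  have mB: "m v \<in> B \<longleftrightarrow> v \<in> B" if "v \<in> V" for v using m that by metis
  have mem: "u \<in> nbrs S v \<longleftrightarrow> (v = x \<and> u \<in> V - {x} - B) \<or> (u = x \<and> v \<in> V - {x} - B) \<or>
      (v = y \<and> u \<in> B) \<or> (u = y \<and> v \<in> B) \<or> (v \<in> V \<and> m v = u \<and> u \<noteq> v)" for u v
  proof -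
    have "u \<in> nbrs S v \<longleftrightarrow> (\<exists>w \<in> V - {x} - B. {u, v} = {x, w}) \<or> (\<exists>w \<in> B. {u, v} = {y, w}) \<or>
        (\<exists>w \<in> V. m w \<noteq> w \<and> {u, v} = {w, m w})"
      unfolding nbrs_def S_def by blast
    moreover have "(\<exists>w \<in> V. m w \<noteq> w \<and> {u, v} = {w, m w}) \<longleftrightarrow> v \<in> V \<and> m v = u \<and> u \<noteq> v"
      unfolding doubleton_eq_iff using m(1,2) by metis
    moreover have "(\<exists>w \<in> W. {u, v} = {z, w}) \<longleftrightarrow> u = z \<and> v \<in> W \<or> v = z \<and> u \<in> W" for z W
      by (auto simp: doubleton_eq_iff)
    ultimately show ?thesis by (simp only:) argo
  qed
  have inV: "v \<in> V" if "u \<in> nbrs S v" for u v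
    using that SE nb[of u] nbrs_sym[of v E u] unfolding nbrs_def by blast
  have rx: "nbrs S x = V - {x} - B"
    using x y B m(4) by (auto simp: mem)
  have ry: "nbrs S y = {x, m y} \<union> B"
    using x y B m(4,5) by (auto simp: mem)
  have rB: "nbrs S v = {y} \<union> ({m v} - {v})" if "v \<in> B" for v
    using that B(1) by (auto simp: mem)
  have rR: "nbrs S v = {x} \<union> ({m v} - {v})" if "v \<in> V" "v \<notin> B" "v \<noteq> x" "v \<noteq> y" for v
    using that by (auto simp: mem)
  have yB: "y \<notin> B" "x \<notin> B" using B by auto
  have myB: "m y \<notin> B" "m y \<noteq> x" using mB[OF y(1)] mx[OF y(1,2)] yB by auto
  \<comment> \<open>The only possible common red neighbour with \<open>x\<close> is
    \<open>m y\<close> for \<open>u = y\<close>, \<open>y\<close> for \<open>u\<close> in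
    \<open>B\<close>, and \<open>m u\<close> for the remaining \<open>u\<close>.\<close>
  have C4x: "p = q" if "u \<noteq> x" "p \<in> nbrs S x \<inter> nbrs S u" "q \<in> nbrs S x \<inter> nbrs S u" for u p q
  proof -
    consider "u \<notin> V" | "u = y" | "u \<in> B" | "u \<in> V" "u \<notin> B" "u \<noteq> y" by blast
    then show ?thesis
    proof cases
      case 1
      then show ?thesis using that inV by blast
    next
      case 2
      then show ?thesis using that by (auto simp: rx ry)
    next
      case 3
      then show ?thesis using that m(3)[OF 3] by (auto simp: rx rB)
    next
      case 4
      then show ?thesis using that by (auto simp: rx rR)
    qed
  qed
  \<comment> \<open>A vertex \<open>u\<close> of \<open>B\<close> can share only \<open>m u\<close>
    with \<open>y\<close>; any other \<open>u\<close> can share only \<open>x\<close>, as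
    \<open>m u\<close> avoids \<open>B\<close> and \<open>m y\<close>.\<close>
  have C4y: "p = q" if "u \<noteq> x" "u \<noteq> y" "p \<in> nbrs S y \<inter> nbrs S u" "q \<in> nbrs S y \<inter> nbrs S u" for u p q
  proof -
    consider "u \<notin> V" | "u \<in> B" | "u \<in> V" "u \<notin> B" by blast
    then show ?thesis
    proof cases
      case 1
      then show ?thesis using that inV by blast
    next
      case 2
      then have "m u \<noteq> x" "y \<noteq> m y" using yB m(3,5) by auto
      then show ?thesis using that 2 yB y by (auto simp: ry rB)
    next
      case 3
      then have "m u \<noteq> m y" "m u \<notin> B" "m u \<noteq> x" using m(2)[OF y(1)] m(2)[of u] mB[of u] mx[of u] that by auto
      then show ?thesis using that 3 by (auto simp: ry rR)
    qed
  qed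
  have C4: "p = q" if "u \<noteq> v" "p \<in> nbrs S u \<inter> nbrs S v" "q \<in> nbrs S u \<inter> nbrs S v" for u v p q
  proof (cases "u = x \<or> u = y \<or> v = x \<or> v = y")
    case True
    then show ?thesis using C4x[of v p q] C4x[of u p q] C4y[of v p q] C4y[of u p q] that by blast
  next
    case False
    have V: "u \<in> V" "v \<in> V" using that inV by blast+
    \<comment> \<open>\<open>P v\<close> is the hub to which \<open>v\<close> is red. As mates
      differ, sharing two red neighbours would force \<open>m u = P v\<close> and
      \<open>m v = P u\<close>. No such mate is \<open>x\<close>, so both hubs would be
      \<open>y\<close> and \<open>u\<close>, \<open>v\<close> would lie in \<open>B\<close>; but
      mates of vertices of \<open>B\<close> stay in \<open>B\<close>, which misses
      \<open>y\<close>.\<close>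
    define P where "P = (\<lambda>v. if v \<in> B then y else x)"
    have sub: "nbrs S u \<subseteq> {P u, m u}" "nbrs S v \<subseteq> {P v, m v}"
      using False V rB rR by (auto simp: P_def)
    have "m u \<noteq> m v" using m(2) V that(1) by metis
    moreover have "\<not> (m u = P v \<and> m v = P u)"
      using mx[OF V(1)] mx[OF V(2)] False mB[OF V(1)] yB by (auto simp: P_def split: if_splits)
    moreover have "p = P u \<or> p = m u" "p = P v \<or> p = m v" "q = P u \<or> q = m u" "q = P v \<or> q = m v"
      using that(2,3) sub by auto
    ultimately show ?thesis by metis
  qed
  have "card (nbrs E v - nbrs S v) < k" for v
  proof -
    have sub: "nbrs S v \<subseteq> nbrs E v" using SE by (auto simp: nbrs_def)
    then have diff: "card (nbrs E v - nbrs S v) = card (nbrs E v) - card (nbrs S v)"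
      using finn by (meson card_Diff_subset finite_subset)
    consider "v \<notin> V" | "v = x" | "v = y" | "v \<in> V" "v \<noteq> x" "v \<noteq> y" by blast
    then show ?thesis
    proof cases
      case 1
      then have "nbrs E v = {}" using nb nbrs_sym[of _ E v] by blast
      then show ?thesis using k by simp
    next
      case 2
      then have "nbrs E v - nbrs S v \<subseteq> B" using nb[of x] rx by blast
      then have "card (nbrs E v - nbrs S v) \<le> card B"
        using B(1) fin by (meson card_mono finite_Diff finite_subset)
      then show ?thesis using B(2) k by simp
    next
      case 3
      \<comment> \<open>These are \<open>x\<close>, \<open>m y\<close> and the \<open>k - 1\<close>
        vertices of \<open>B\<close>.\<close>
      have "card (nbrs S y) = k + 1"
        using B(2) yB myB k finite_subset[OF B(1)] fin by (simp add: ry)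
      then show ?thesis using 3 y(3) diff k by simp
    next
      case 4
      have "card (nbrs S v) = (if m v = v then 1 else 2)"
      proof (cases "v \<in> B")
        case True
        then have "m v \<noteq> y" using m(3) yB by metis
        then show ?thesis by (simp add: rB[OF True])
      next
        case False
        then show ?thesis using mx[OF 4(1,2)] by (simp add: rR[OF 4(1) False 4(2,3)])
      qed
      then show ?thesis using deg[OF 4] diff k by (auto split: if_splits)
    qed
  qed
  then have "critical_colouring k \<lparr>verts = V, edges = E\<rparr> c"
    unfolding critical_colouring_iff[OF E fin k] red blue using C4 by blast
  then show ?thesis by blast
qed

text \<open>An added edge avoids \<open>x\<close>, which is already joined to every vertex, and
  \<open>y\<close>, whose degree has to remain \<open>2 * k\<close>. Its ends may reach degree at
  most \<open>k + 1\<close>, so both had degree at most \<open>k\<close> before and were adjacent by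
  \<open>low\<close>.\<close>

lemma co_criticalI:
  assumes E: "E \<subseteq> all_pairs V" and fin: "finite V" and k: "k > 0"
    and card: "card V \<ge> 2 * k + 2"
    and x: "x \<in> V" "\<And>v. v \<in> V \<Longrightarrow> v \<noteq> x \<Longrightarrow> {x, v} \<in> E"
    and y: "y \<in> V" "y \<noteq> x" "card (nbrs E y) = 2 * k"
    and B: "B \<subseteq> V - {x, y}" "card B = k - 1" "\<And>v. v \<in> B \<Longrightarrow> {y, v} \<in> E"
    and m: "\<And>v. v \<in> V \<Longrightarrow> m v \<in> V" "\<And>v. v \<in> V \<Longrightarrow> m (m v) = v" "\<And>v. v \<in> B \<Longrightarrow> m v \<in> B"
      "m x = x" "m y \<noteq> y" "\<And>v. v \<in> V \<Longrightarrow> m v \<noteq> v \<Longrightarrow> {v, m v} \<in> E"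
    and deg: "\<And>v. v \<in> V \<Longrightarrow> v \<noteq> x \<Longrightarrow> v \<noteq> y \<Longrightarrow> card (nbrs E v) \<le> (if m v = v then k else k + 1)"
    and low: "\<And>u v. u \<in> V \<Longrightarrow> v \<in> V \<Longrightarrow> u \<noteq> v \<Longrightarrow> card (nbrs E u) \<le> k \<Longrightarrow> card (nbrs E v) \<le> k \<Longrightarrow>
      {u, v} \<in> E"
  shows "co_critical k \<lparr>verts = V, edges = E\<rparr>"
proof -
  have "\<exists>c. critical_colouring k \<lparr>verts = V, edges = E\<rparr> c"
    using critical_colouring_hubs[OF E fin k x y(1,2) _ B m deg] y(3) by simp
  \<comment> \<open>In a complete graph \<open>y\<close> would have degree at least
    \<open>2 * k + 1\<close>.\<close>
  moreover have "E \<noteq> all_pairs V"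
  proof
    assume "E = all_pairs V"
    then have "nbrs E y = V - {y}"
      using y(1) by (auto simp: nbrs_def all_pairs_def card_2_iff)
    then show False using y card fin by simp
  qed
  moreover have "\<not> critical_colouring k \<lparr>verts = V, edges = insert e E\<rparr> c"
    if e: "e \<in> all_pairs V" "e \<notin> E" for e c
  proof
    assume crit: "critical_colouring k \<lparr>verts = V, edges = insert e E\<rparr> c"
    obtain u v where uv: "e = {u, v}" "u \<noteq> v" "u \<in> V" "v \<in> V"
      using e(1) by (auto simp: all_pairs_def card_2_iff)
    have "finite (nbrs E w)" for w
      using nbrs_subset[OF E] fin by (meson finite_Diff finite_subset)
    then have ins: "card (nbrs (insert e E) w) = card (nbrs E w) + of_bool (w = u \<or> w = v)" for w
      using card_nbrs_insert[OF uv(2)] e(2) uv(1) by simp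
    have sub: "insert e E \<subseteq> all_pairs V" using E e by blast
    have x': "{x, w} \<in> insert e E" if "w \<in> V" "w \<noteq> x" for w
      using x(2) that by blast
    have y': "2 * k \<le> card (nbrs (insert e E) y)"
      using y(3) ins[of y] by simp
    note d = critical_colouring_degrees[OF sub fin k crit x(1) x' y(1,2) y']
    have "u \<noteq> x" "v \<noteq> x" using x(2) uv e(2) by (auto simp: insert_commute)
    moreover have "u \<noteq> y" "v \<noteq> y" using d(1) y(3) ins[of y] by auto
    ultimately have "card (nbrs E u) \<le> k" "card (nbrs E v) \<le> k"
      using d(2)[of u] d(2)[of v] uv ins[of u] ins[of v] by simp_all
    then show False using low uv e(2) by blast
  qed
  ultimately show ?thesis
    using E fin by (auto simp: co_critical_def simple_graph_def complete_graph_def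
        complement_graph_def add_edge_def)
qed

section \<open>The core graph: a circulant with a matching and two hubs\<close>

text \<open>
  The core graph lives on \<open>{..<2 * c}\<close> with \<open>x = 0\<close> and \<open>y = 2 * h + 1\<close>, where \<open>k\<close> is \<open>2 * h + 1\<close>
  or, if \<open>ev\<close> holds, \<open>2 * h + 2\<close>. The antipode \<open>c\<close> of \<open>x\<close> is the only vertex besides \<open>x\<close> without
  a mate. For even \<open>k\<close> the circulant edge between \<open>0\<close> and \<open>c\<close> is coloured red in the end: the extra
  vertex \<open>2 * c\<close> subdivides it in the blue graph.
\<close>

definition circulant :: "bool \<Rightarrow> nat \<Rightarrow> nat \<Rightarrow> nat \<Rightarrow> nat set" where
  "circulant ev c h v = {u. u < 2 * c \<and> u \<noteq> v \<and>
     (if v < u then u - v else 2 * c + u - v) \<in> {1..h} \<union> {2 * c - h..<2 * c} \<union> (if ev then {c} else {})}"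

text \<open>Sending \<open>u\<close> to its clockwise distance from \<open>v\<close> identifies the
  neighbourhood with the set of allowed distances; \<open>h < c\<close> keeps the two arcs and the
  antipodal distance \<open>c\<close> disjoint.\<close>

lemma card_circulant:
  assumes "h < c" and "v < 2 * c"
  shows "card (circulant ev c h v) = 2 * h + of_bool ev"
proof -
  let ?D = "{1..h} \<union> {2 * c - h..<2 * c} \<union> (if ev then {c} else {})"
  have "card (circulant ev c h v) = card ?D"
  proof (rule bij_betw_same_card)
    show "bij_betw (\<lambda>u. if v < u then u - v else 2 * c + u - v) (circulant ev c h v) ?D"
      by (rule bij_betw_byWitness[where f' = "\<lambda>d. if v + d < 2 * c then v + d else v + d - 2 * c"])
        (use assms in \<open>auto simp: circulant_def split: if_splits\<close>)
  qed
  also have "card ?D = card ({1..h} \<union> {2 * c - h..<2 * c}) + card (if ev then {c} else {})"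
    by (rule card_Un_disjoint) (use assms in auto)
  also have "card ({1..h} \<union> {2 * c - h..<2 * c}) = card {1..h} + card {2 * c - h..<2 * c}"
    by (rule card_Un_disjoint) (use assms in auto)
  finally show ?thesis using assms by simp
qed

lemma circulant_sym:
  assumes "u < 2 * c" and "v < 2 * c"
  shows "u \<in> circulant ev c h v \<longleftrightarrow> v \<in> circulant ev c h u"
  using assms by (auto simp: circulant_def split: if_splits)

text \<open>The circulant neighbours of \<open>0\<close>, apart from a possible antipode. They form
  the core part of the set \<open>B\<close> that is blue to \<open>x\<close> and red to
  \<open>y\<close>.\<close>

definition near :: "nat \<Rightarrow> nat \<Rightarrow> nat set" where
  "near c h = {1..h} \<union> {2 * c - h..<2 * c}"

text \<open>Vertices are paired at distance \<open>2 * c - h - 1\<close> within \<open>near\<close>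
  and \<open>c - h\<close> outside. Under the bounds imposed below, these distances and their
  reversals \<open>h + 1\<close> and \<open>c + h\<close> are missed by the circulant, so red
  matching edges are new.\<close>

definition mate :: "nat \<Rightarrow> nat \<Rightarrow> nat \<Rightarrow> nat" where
  "mate c h v =
    (if v = 0 \<or> v = c \<or> v \<ge> 2 * c then v
     else if v \<le> h then v + (2 * c - h - 1)
     else if v < c then v + (c - h)
     else if v < 2 * c - h then v - (c - h)
     else v - (2 * c - h - 1))"

text \<open>Given by neighbourhoods, so that degrees can be read off once symmetry is proved.
  Removing \<open>v\<close> from its mate prevents a loop at \<open>c\<close>.\<close>

definition core_nbrs :: "bool \<Rightarrow> nat \<Rightarrow> nat \<Rightarrow> nat \<Rightarrow> nat set" where
  "core_nbrs ev c h v = (if v \<ge> 2 * c then {} else if v = 0 then {1..<2 * c} else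
     circulant ev c h v \<union> {0} \<union> ({mate c h v} - {v}) \<union>
     (if v = 2 * h + 1 then near c h else if v \<in> near c h then {2 * h + 1} else {}))"

definition core :: "bool \<Rightarrow> nat \<Rightarrow> nat \<Rightarrow> nat set set" where
  "core ev c h = {{u, v} | u v. u \<in> core_nbrs ev c h v}"

context
  fixes c h :: nat
  assumes h: "1 \<le> h" and c: "3 * h + 2 \<le> c"
begin

lemma mate_simps:
  "v = 0 \<or> v = c \<or> v \<ge> 2 * c \<Longrightarrow> mate c h v = v"
  "1 \<le> v \<Longrightarrow> v \<le> h \<Longrightarrow> mate c h v = v + (2 * c - h - 1)"
  "h < v \<Longrightarrow> v < c \<Longrightarrow> mate c h v = v + (c - h)"
  "c < v \<Longrightarrow> v < 2 * c - h \<Longrightarrow> mate c h v = v - (c - h)"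
  "2 * c - h \<le> v \<Longrightarrow> v < 2 * c \<Longrightarrow> mate c h v = v - (2 * c - h - 1)"
  using h c by (auto simp: mate_def)

lemma mate_cases:
  obtains "v = 0 \<or> v = c \<or> v \<ge> 2 * c" | "1 \<le> v" "v \<le> h" | "h < v" "v < c"
    | "c < v" "v < 2 * c - h" | "2 * c - h \<le> v" "v < 2 * c"
  by linarith

lemma mate_mate: "mate c h (mate c h v) = v"
  using h c by (cases v rule: mate_cases) (simp_all add: mate_simps)

lemma mate_near: "mate c h v \<in> near c h \<longleftrightarrow> v \<in> near c h"
  using h c by (cases v rule: mate_cases) (auto simp: mate_simps near_def)

lemma mate_less: "v < 2 * c \<Longrightarrow> mate c h v < 2 * c"
  using h c by (cases v rule: mate_cases) (simp_all add: mate_simps)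

lemma mate_eq_iff: "mate c h v = v \<longleftrightarrow> v = 0 \<or> v = c \<or> v \<ge> 2 * c"
  using h c by (cases v rule: mate_cases) (auto simp: mate_simps)

lemma mate_eq_0_iff: "mate c h v = 0 \<longleftrightarrow> v = 0"
  using h c by (cases v rule: mate_cases) (auto simp: mate_simps)

lemma mate_not_circulant: "mate c h v \<notin> circulant ev c h v"
  using h c by (cases v rule: mate_cases) (auto simp: mate_simps circulant_def)

text \<open>The bound \<open>3 * h + 2 \<le> c\<close> says precisely that the antipode
  \<open>c + 2 * h + 1\<close> of \<open>y\<close> lies below the upper arc of \<open>near\<close>,
  which starts at \<open>2 * c - h\<close>.\<close>

lemma near_not_circulant: "near c h \<inter> circulant ev c h (2 * h + 1) = {}"
  using h c by (auto simp: near_def circulant_def)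

lemma zero_circulant: "0 < v \<Longrightarrow> v < 2 * c \<Longrightarrow> 0 \<in> circulant ev c h v \<longleftrightarrow> v \<in> near c h \<or> ev \<and> v = c"
  using h c by (auto simp: near_def circulant_def)

lemma near_props:
  "0 \<notin> near c h" "c \<notin> near c h" "2 * h + 1 \<notin> near c h" "finite (near c h)" "card (near c h) = 2 * h"
  "near c h \<subseteq> {..<2 * c}"
proof -
  have "card (near c h) = card {1..h} + card {2 * c - h..<2 * c}"
    unfolding near_def using h c by (intro card_Un_disjoint) auto
  then show "card (near c h) = 2 * h" using c by simp
qed (use h c in \<open>auto simp: near_def\<close>)

lemma core_nbrs_less: "u \<in> core_nbrs ev c h v \<Longrightarrow> u < 2 * c \<and> v < 2 * c \<and> u \<noteq> v"
  using h c mate_less[of v] near_props by (auto simp: core_nbrs_def circulant_def split: if_splits)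

lemma core_nbrs_sym: "u \<in> core_nbrs ev c h v \<Longrightarrow> v \<in> core_nbrs ev c h u"
proof -
  assume u: "u \<in> core_nbrs ev c h v"
  then have *: "u < 2 * c" "v < 2 * c" "u \<noteq> v" using core_nbrs_less by blast+
  then show ?thesis
    using u circulant_sym[OF *(1,2), of ev h] mate_mate[of u] mate_mate[of v] near_props
    by (auto simp: core_nbrs_def split: if_splits)
qed

lemma nbrs_core: "nbrs (core ev c h) v = core_nbrs ev c h v"
  using core_nbrs_sym by (auto simp: nbrs_def core_def doubleton_eq_iff)

lemma core_subset: "core ev c h \<subseteq> all_pairs {..<2 * c}"
  using core_nbrs_less by (fastforce simp: core_def all_pairs_def)

lemma card_nbrs_core:
  assumes "v < 2 * c"
  shows "card (nbrs (core ev c h) v) =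
    (if v = 0 then 2 * c - 1 else if v = 2 * h + 1 then 4 * h + 2 + of_bool ev
     else if v = c then 2 * h + 1 else 2 * h + 2 + of_bool ev)"
proof -
  let ?C = "circulant ev c h v" and ?m = "mate c h v" and ?y = "2 * h + 1"
  have fin: "finite ?C" by (simp add: circulant_def)
  have card: "card ?C = 2 * h + of_bool ev" using c assms by (intro card_circulant) auto
  have hy: "?y < c" using c by simp
  consider "v = 0" | "v = ?y" | "v = c" | "v \<noteq> 0" "v \<noteq> ?y" "v \<noteq> c" by blast
  then show ?thesis
  proof cases
    case 1
    then show ?thesis using c by (simp add: nbrs_core core_nbrs_def)
  next
    case 2
    have "core_nbrs ev c h v = ?C \<union> ({0, ?m} \<union> near c h)"
      using 2 hy mate_eq_iff[of v] by (auto simp: core_nbrs_def)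
    moreover have "?C \<inter> ({0, ?m} \<union> near c h) = {}"
      using 2 hy near_not_circulant[of ev] zero_circulant[of v ev] mate_not_circulant[of v ev]
        near_props by auto
    moreover have "card ({0, ?m} \<union> near c h) = 2 * h + 2"
      using 2 near_props mate_near[of v] mate_eq_0_iff[of v] by simp
    ultimately show ?thesis
      using 2 fin card near_props(4) hy by (cases ev) (simp_all add: nbrs_core card_Un_disjoint del: Un_insert_right)
  next
    case 3
    \<comment> \<open>If \<open>ev\<close> holds, \<open>0\<close> is the antipode of
      \<open>c\<close> and already belongs to \<open>?C\<close>; so both parities give degree
      \<open>2 * h + 1\<close>.\<close>
    have "core_nbrs ev c h v = insert 0 ?C"
      using 3 hy near_props mate_eq_iff[of v] by (auto simp: core_nbrs_def)
    then show ?thesis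
      using 3 fin card hy zero_circulant[of v ev] near_props
      by (cases ev) (simp_all add: nbrs_core card_insert_if)
  next
    case 4
    \<comment> \<open>A vertex of \<open>near\<close> already has \<open>0\<close> as a circulant
      neighbour but gains \<open>y\<close> instead, so the degree is the same on both sides.\<close>
    let ?p = "if v \<in> near c h then ?y else 0"
    have "core_nbrs ev c h v = ?C \<union> {?p, ?m}"
      using 4 assms zero_circulant[of v ev] mate_eq_iff[of v] by (auto simp: core_nbrs_def)
    moreover have "v \<in> near c h \<Longrightarrow> ?y \<notin> ?C"
      using near_not_circulant[of ev] circulant_sym[of ?y c v ev h] hy assms by auto
    then have "?C \<inter> {?p, ?m} = {}"
      using 4 assms zero_circulant[of v ev] mate_not_circulant[of v ev] by auto
    moreover have "?p \<noteq> ?m"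
      using 4 mate_eq_0_iff[of v] mate_near[of v] near_props by metis
    ultimately show ?thesis
      using 4 fin card by (cases ev) (simp_all add: nbrs_core card_Un_disjoint del: Un_insert_right)
  qed
qed

text \<open>The handshake sum with the three exceptional vertices split off, in additive form to
  avoid truncated subtraction.\<close>

lemma card_core:
  "card (core ev c h) + 2 + of_bool ev = c * (2 * h + 3 + of_bool ev)"
proof -
  let ?d = "2 * h + 2 + of_bool ev :: nat"
  let ?f = "\<lambda>v. card (nbrs (core ev c h) v)"
  have sub: "{0, 2 * h + 1, c} \<subseteq> {..<2 * c}" using c by auto
  have "2 * card (core ev c h) = (\<Sum>v<2 * c. ?f v)"
    using handshake[OF _ core_subset, of ev] by simp
  also have "\<dots> = (\<Sum>v\<in>{..<2 * c} - {0, 2 * h + 1, c}. ?f v) + (\<Sum>v\<in>{0, 2 * h + 1, c}. ?f v)"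
    using sub by (intro sum.subset_diff) auto
  also have "(\<Sum>v\<in>{..<2 * c} - {0, 2 * h + 1, c}. ?f v) = (\<Sum>v\<in>{..<2 * c} - {0, 2 * h + 1, c}. ?d)"
    by (intro sum.cong) (auto simp: card_nbrs_core)
  also have "\<dots> = (2 * c - 3) * ?d"
    using c sub by (simp add: card_Diff_subset numeral_3_eq_3)
  also have "(\<Sum>v\<in>{0, 2 * h + 1, c}. ?f v) = 2 * c + 6 * h + 2 + of_bool ev"
    using c by (simp add: card_nbrs_core)
  finally have "2 * card (core ev c h) + 3 * ?d = (2 * c - 3 + 3) * ?d + (2 * c + 6 * h + 2 + of_bool ev)"
    by (simp add: algebra_simps)
  also have "2 * c - 3 + 3 = 2 * c" using c by simp
  finally show ?thesis by (simp add: algebra_simps)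
qed

lemma mate_eq_c_iff: "mate c h v = c \<longleftrightarrow> v = c"
  using mate_mate[of v] mate_eq_iff[of c] by metis

lemma core_edges:
  "v < 2 * c \<Longrightarrow> v \<noteq> 0 \<Longrightarrow> {0, v} \<in> core ev c h"
  "v \<in> near c h \<Longrightarrow> {2 * h + 1, v} \<in> core ev c h"
  "v < 2 * c \<Longrightarrow> mate c h v \<noteq> v \<Longrightarrow> {v, mate c h v} \<in> core ev c h"
  "2 * c \<le> v \<Longrightarrow> {u, v} \<notin> core ev c h"
proof -
  have *: "{u, v} \<in> core ev c h \<longleftrightarrow> u \<in> core_nbrs ev c h v" for u v
    using nbrs_core[of ev v] by (auto simp: nbrs_def)
  show "v < 2 * c \<Longrightarrow> v \<noteq> 0 \<Longrightarrow> {0, v} \<in> core ev c h"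
    by (simp add: * core_nbrs_def)
  show "v \<in> near c h \<Longrightarrow> {2 * h + 1, v} \<in> core ev c h"
    using near_props c by (auto simp: * core_nbrs_def)
  show "v < 2 * c \<Longrightarrow> mate c h v \<noteq> v \<Longrightarrow> {v, mate c h v} \<in> core ev c h"
    using mate_eq_iff[of v]
    by (subst insert_commute) (simp add: * core_nbrs_def)
  show "2 * c \<le> v \<Longrightarrow> {u, v} \<notin> core ev c h"
    by (simp add: * core_nbrs_def)
qed

lemma finite_core: "finite (core ev c h)"
proof (rule finite_subset)
  show "core ev c h \<subseteq> Pow {..<2 * c}" using core_subset[of ev] by (auto simp: all_pairs_def)
qed simp

lemma nbrs_core_outside: "2 * c \<le> v \<Longrightarrow> nbrs (core ev c h) v = {}"
  by (simp add: nbrs_def core_edges(4))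

lemma finite_nbrs_core: "finite (nbrs (core ev c h) v)"
  using core_subset[of ev] nbrs_subset by (meson finite_Diff finite_lessThan finite_subset)

lemma all_pairs_core: "2 * c \<le> n \<Longrightarrow> core ev c h \<subseteq> all_pairs {..<n}"
  using core_subset[of ev] by (fastforce simp: all_pairs_def)

lemma card_nbrs_core_all:
  "card (nbrs (core ev c h) v) =
    (if v \<ge> 2 * c then 0 else if v = 0 then 2 * c - 1 else if v = 2 * h + 1 then 4 * h + 2 + of_bool ev
     else if v = c then 2 * h + 1 else 2 * h + 2 + of_bool ev)"
  using card_nbrs_core[of v ev] nbrs_core_outside[of v ev] by (simp add: not_le)

section \<open>Extra vertices and the four parity cases\<close>

text \<open>Confines the remaining checks to \<open>W\<close>, which contains every vertex of degree
  at most \<open>k\<close>. There \<open>s\<close> replaces \<open>mate\<close>, so that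
  \<open>c\<close>, unmatched in the core, can get an extra vertex as its mate. The set
  \<open>B\<close> brings \<open>near\<close> up to \<open>k - 1\<close> elements.\<close>

lemma co_critical_extension:
  fixes n k :: nat
  defines "W \<equiv> insert c {2 * c..<n}"
  assumes core: "core ev c h \<subseteq> E" and E: "E \<subseteq> all_pairs {..<n}"
    and n: "2 * c \<le> n" "2 * k + 2 \<le> n" and k: "k > 0"
    and zero: "\<And>v. 2 * c \<le> v \<Longrightarrow> v < n \<Longrightarrow> {0, v} \<in> E"
    and B: "B \<subseteq> {2 * c..<n}" "2 * h + card B + 1 = k" "\<And>v. v \<in> B \<Longrightarrow> {2 * h + 1, v} \<in> E"
    and s: "\<And>v. v \<in> W \<Longrightarrow> s v \<in> W" "\<And>v. v \<in> W \<Longrightarrow> s (s v) = v"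
      "\<And>v. v \<in> B \<Longrightarrow> s v \<in> B" "\<And>v. v \<in> W \<Longrightarrow> s v \<noteq> v \<Longrightarrow> {v, s v} \<in> E"
    and deg_y: "card (nbrs E (2 * h + 1)) = 2 * k"
    and deg: "\<And>v. v < 2 * c \<Longrightarrow> v \<noteq> 0 \<Longrightarrow> v \<noteq> 2 * h + 1 \<Longrightarrow> v \<noteq> c \<Longrightarrow> card (nbrs E v) = k + 1"
      "\<And>v. v \<in> W \<Longrightarrow> card (nbrs E v) \<le> (if s v = v then k else k + 1)"
    and low: "\<And>u v. u \<in> W \<Longrightarrow> v \<in> W \<Longrightarrow> u < v \<Longrightarrow> card (nbrs E u) \<le> k \<Longrightarrow> card (nbrs E v) \<le> k \<Longrightarrow>
      {u, v} \<in> E"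
  shows "co_critical k \<lparr>verts = {..<n}, edges = E\<rparr>"
proof -
  define m where "m = (\<lambda>v. if v \<in> W then s v else mate c h v)"
  let ?y = "2 * h + 1"
  have y: "?y < c" "?y \<notin> W" "?y \<noteq> 0" using c n by (auto simp: W_def)
  have W: "v < n" if "v \<in> W" for v using that n c by (auto simp: W_def)
  have notW: "v < 2 * c" "v \<noteq> c" if "v < n" "v \<notin> W" for v using that by (auto simp: W_def)
  have W0: "0 \<notin> W" using c by (auto simp: W_def)
  \<comment> \<open>Hence gluing \<open>s\<close> on \<open>W\<close> to \<open>mate\<close>
    elsewhere yields an involution.\<close>
  have mate_W: "mate c h v \<in> W \<longleftrightarrow> v \<in> W" if "v < n" for v
  proof (cases "v < 2 * c")
    case True
    then show ?thesis
      using mate_less[OF True] mate_eq_c_iff[of v] by (simp add: W_def)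
  next
    case False
    then have "mate c h v = v" using mate_eq_iff[of v] by simp
    then show ?thesis by simp
  qed
  have B_W: "B \<subseteq> W" using B by (auto simp: W_def)
  have near_W: "v \<notin> W" if "v \<in> near c h" for v using that near_props by (auto simp: W_def)
  have fB: "finite B" using B(1) finite_subset by blast
  have degs: "card (nbrs E v) \<le> (if m v = v then k else k + 1) \<and> (card (nbrs E v) \<le> k \<longrightarrow> v \<in> W)"
    if "v < n" "v \<noteq> 0" "v \<noteq> ?y" for v
    using that deg(1)[of v] deg(2)[of v] notW[of v] mate_eq_iff[of v] by (auto simp: m_def)
  have zero': "{0, v} \<in> E" if "v < n" "v \<noteq> 0" for v
    using that zero[of v] core core_edges(1)[of v ev] by (cases "v < 2 * c") auto
  have deg_0: "card (nbrs E 0) > k"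
  proof -
    have "{1..<n} \<subseteq> nbrs E 0" using zero' by (auto simp: nbrs_def insert_commute)
    moreover have "finite (nbrs E 0)" using nbrs_subset[OF E] by (meson finite_Diff finite_lessThan finite_subset)
    ultimately have "card {1..<n} \<le> card (nbrs E 0)" by (rule card_mono[rotated])
    then show ?thesis using n by simp
  qed
  show ?thesis
  proof (rule co_criticalI[where x = 0 and y = ?y and B = "near c h \<union> B" and m = m])
    show "near c h \<union> B \<subseteq> {..<n} - {0, ?y}"
      using near_props B_W W0 y W n by auto
    have "near c h \<inter> B = {}" using near_W B_W by auto
    then show "card (near c h \<union> B) = k - 1"
      using near_props fB B(2) by (simp add: card_Un_disjoint)
    show "{?y, v} \<in> E" if "v \<in> near c h \<union> B" for v
      using that B(3) core core_edges(2)[of v ev] by auto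
    show "m v \<in> {..<n}" if "v \<in> {..<n}" for v
      using that W s(1) n mate_less[of v] notW[of v] by (auto simp: m_def)
    show "m (m v) = v" if "v \<in> {..<n}" for v
      using that s(1,2) mate_W mate_mate by (auto simp: m_def)
    show "m v \<in> near c h \<union> B" if "v \<in> near c h \<union> B" for v
      using that near_W[of v] B_W s(3)[of v] mate_near[of v] by (auto simp: m_def)
    show "m 0 = 0" using W0 mate_eq_iff[of 0] by (simp add: m_def)
    show "m ?y \<noteq> ?y" using y mate_eq_iff[of ?y] by (simp add: m_def)
    show "{v, m v} \<in> E" if "v \<in> {..<n}" "m v \<noteq> v" for v
      using that s(4)[of v] core core_edges(3)[of v ev] notW[of v] by (auto simp: m_def split: if_splits)
    show "{u, v} \<in> E" if "u \<in> {..<n}" "v \<in> {..<n}" "u \<noteq> v"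
      and le: "card (nbrs E u) \<le> k" "card (nbrs E v) \<le> k" for u v
    proof -
      have "w \<in> W" if "w < n" "card (nbrs E w) \<le> k" for w
        using that degs[of w] deg_0 deg_y k by (cases "w = 0"; cases "w = ?y") auto
      then have "u \<in> W" "v \<in> W" using that le by simp_all
      then show ?thesis using low[of u v] low[of v u] le that(3) by (metis insert_commute linorder_neqE_nat)
    qed
  qed (use E n k zero' y deg_y degs in auto)
qed

text \<open>The mate \<open>2 * c\<close> raises \<open>c\<close> to degree \<open>k + 1\<close>.
  The vertex \<open>2 * c + 1\<close> stays unmatched, and joining it to \<open>2 * c\<close> makes
  the low vertices a clique.\<close>

lemma construction_k_odd_n_even:
  fixes k n :: nat
  assumes k: "k = 2 * h + 1" and n: "n = 2 * c + 2"
    and E: "E = {{0, 2 * c}, {c, 2 * c}, {0, 2 * c + 1}, {2 * c, 2 * c + 1}} \<union> core False c h"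
  shows "co_critical k \<lparr>verts = {..<n}, edges = E\<rparr>"
    and "card E = card (core False c h) + 4"
proof -
  let ?s = "id(c := 2 * c, 2 * c := c)"
  have deg: "card (nbrs E v) = (if v = 0 then n - 1 else if v = 2 * h + 1 then 2 * k
      else if v = 2 * c then 3 else if v = 2 * c + 1 then 2 else if v < n then k + 1 else 0)" for v
    using h c unfolding E k n
    by (simp add: card_nbrs_insert core_edges(4) finite_nbrs_core finite_nbrs_insert card_nbrs_core_all
        doubleton_eq_iff)
  show "card E = card (core False c h) + 4"
    using h c unfolding E by (simp add: core_edges(4) finite_core doubleton_eq_iff)
  have W: "insert c {2 * c..<n} = {c, 2 * c, 2 * c + 1}" using n by auto
  show "co_critical k \<lparr>verts = {..<n}, edges = E\<rparr>"
  proof (rule co_critical_extension[where ev = False and B = "{}" and s = ?s], unfold W)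
    show "core False c h \<subseteq> E" by (auto simp: E)
    show "E \<subseteq> all_pairs {..<n}"
      using all_pairs_core[of n False] h c n by (auto simp: E all_pairs_def)
    show "{0, v} \<in> E" if "2 * c \<le> v" "v < n" for v
    proof -
      have "v = 2 * c \<or> v = 2 * c + 1" using that n by auto
      then show ?thesis by (auto simp: E)
    qed
    show "{2 * h + 1, v} \<in> E" if "v \<in> {}" for v
      using that by (auto simp: E)
    show "{v, ?s v} \<in> E" if "v \<in> {c, 2 * c, 2 * c + 1}" "?s v \<noteq> v" for v
      using that by (auto simp: E insert_commute)
    show "card (nbrs E v) \<le> (if ?s v = v then k else k + 1)" if "v \<in> {c, 2 * c, 2 * c + 1}" for v
      using that h c k n by (auto simp: deg)
    show "{u, v} \<in> E" if "u \<in> {c, 2 * c, 2 * c + 1}" "v \<in> {c, 2 * c, 2 * c + 1}"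
      "u < v" "card (nbrs E u) \<le> k" "card (nbrs E v) \<le> k" for u v
    proof -
      have "u \<noteq> c" using that(4) h c k n by (auto simp: deg)
      then have "u = 2 * c \<and> v = 2 * c + 1" using that(1-3) by auto
      then show ?thesis by (elim disjE conjE) (simp_all add: E)
    qed
  qed (use h c k n in \<open>auto simp: deg\<close>)
qed

text \<open>One more vertex allows everything except \<open>0\<close> to be matched; the three extra
  vertices form a triangle, so low degrees among them do no harm.\<close>

lemma construction_k_odd_n_odd:
  fixes k n :: nat
  assumes k: "k = 2 * h + 1" and n: "n = 2 * c + 3"
    and E: "E = {{0, 2 * c}, {c, 2 * c}, {0, 2 * c + 1}, {2 * c, 2 * c + 1},
      {0, 2 * c + 2}, {2 * c, 2 * c + 2}, {2 * c + 1, 2 * c + 2}} \<union> core False c h"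
  shows "co_critical k \<lparr>verts = {..<n}, edges = E\<rparr>"
    and "card E = card (core False c h) + 7"
proof -
  let ?s = "id(c := 2 * c, 2 * c := c, 2 * c + 1 := 2 * c + 2, 2 * c + 2 := 2 * c + 1)"
  have deg: "card (nbrs E v) = (if v = 0 then n - 1 else if v = 2 * h + 1 then 2 * k
      else if v = 2 * c then 4 else if v = 2 * c + 1 \<or> v = 2 * c + 2 then 3 else if v < n then k + 1 else 0)" for v
    using h c unfolding E k n
    by (simp add: card_nbrs_insert core_edges(4) finite_nbrs_core finite_nbrs_insert card_nbrs_core_all
        doubleton_eq_iff)
  show "card E = card (core False c h) + 7"
    using h c unfolding E by (simp add: core_edges(4) finite_core doubleton_eq_iff)
  have W: "insert c {2 * c..<n} = {c, 2 * c, 2 * c + 1, 2 * c + 2}" using n by auto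
  show "co_critical k \<lparr>verts = {..<n}, edges = E\<rparr>"
  proof (rule co_critical_extension[where ev = False and B = "{}" and s = ?s], unfold W)
    show "core False c h \<subseteq> E" by (auto simp: E)
    show "E \<subseteq> all_pairs {..<n}"
      using all_pairs_core[of n False] h c n by (auto simp: E all_pairs_def)
    show "{0, v} \<in> E" if "2 * c \<le> v" "v < n" for v
    proof -
      have "v = 2 * c \<or> v = 2 * c + 1 \<or> v = 2 * c + 2" using that n by auto
      then show ?thesis by (auto simp: E)
    qed
    show "{2 * h + 1, v} \<in> E" if "v \<in> {}" for v
      using that by (auto simp: E)
    show "{v, ?s v} \<in> E" if "v \<in> {c, 2 * c, 2 * c + 1, 2 * c + 2}" "?s v \<noteq> v" for v
      using that by (auto simp: E insert_commute)
    show "card (nbrs E v) \<le> (if ?s v = v then k else k + 1)" if "v \<in> {c, 2 * c, 2 * c + 1, 2 * c + 2}" for v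
      using that h c k n by (auto simp: deg)
    show "{u, v} \<in> E" if "u \<in> {c, 2 * c, 2 * c + 1, 2 * c + 2}" "v \<in> {c, 2 * c, 2 * c + 1, 2 * c + 2}"
      "u < v" "card (nbrs E u) \<le> k" "card (nbrs E v) \<le> k" for u v
    proof -
      have "u \<noteq> c" using that(4) h c k n by (auto simp: deg)
      then have "u = 2 * c \<and> v = 2 * c + 1 \<or> u = 2 * c \<and> v = 2 * c + 2 \<or> u = 2 * c + 1 \<and> v = 2 * c + 2"
        using that(1-3) by auto
      then show ?thesis by (elim disjE conjE) (simp_all add: E)
    qed
  qed (use h c k n in \<open>auto simp: deg\<close>)
qed

text \<open>The core gives \<open>y\<close> degree \<open>2 * k - 1\<close> and \<open>near\<close>
  has only \<open>k - 2\<close> elements; the vertex \<open>2 * c\<close> corrects both. It and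
  \<open>c\<close>, adjacent and both unmatched, are the low vertices.\<close>

lemma construction_k_even_n_odd:
  fixes k n :: nat
  assumes k: "k = 2 * h + 2" and n: "n = 2 * c + 1"
    and E: "E = {{0, 2 * c}, {2 * h + 1, 2 * c}, {c, 2 * c}} \<union> core True c h"
  shows "co_critical k \<lparr>verts = {..<n}, edges = E\<rparr>"
    and "card E = card (core True c h) + 3"
proof -
  let ?s = "id"
  have deg: "card (nbrs E v) = (if v = 0 then n - 1 else if v = 2 * h + 1 then 2 * k
      else if v = 2 * c then 3 else if v = c then k else if v < n then k + 1 else 0)" for v
    using h c unfolding E k n
    by (simp add: card_nbrs_insert core_edges(4) finite_nbrs_core finite_nbrs_insert card_nbrs_core_all
        doubleton_eq_iff)
  show "card E = card (core True c h) + 3"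
    using h c unfolding E by (simp add: core_edges(4) finite_core doubleton_eq_iff)
  have W: "insert c {2 * c..<n} = {c, 2 * c}" using n by auto
  show "co_critical k \<lparr>verts = {..<n}, edges = E\<rparr>"
  proof (rule co_critical_extension[where ev = True and B = "{2 * c}" and s = ?s], unfold W)
    show "core True c h \<subseteq> E" by (auto simp: E)
    show "E \<subseteq> all_pairs {..<n}"
      using all_pairs_core[of n True] h c n by (auto simp: E all_pairs_def)
    show "{0, v} \<in> E" if "2 * c \<le> v" "v < n" for v
    proof -
      have "v = 2 * c" using that n by auto
      then show ?thesis by (auto simp: E)
    qed
    show "{2 * h + 1, v} \<in> E" if "v \<in> {2 * c}" for v
      using that by (auto simp: E)
    show "{v, ?s v} \<in> E" if "v \<in> {c, 2 * c}" "?s v \<noteq> v" for v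
      using that by (auto simp: E insert_commute)
    show "card (nbrs E v) \<le> (if ?s v = v then k else k + 1)" if "v \<in> {c, 2 * c}" for v
      using that h c k n by (auto simp: deg)
    show "{u, v} \<in> E" if "u \<in> {c, 2 * c}" "v \<in> {c, 2 * c}"
      "u < v" "card (nbrs E u) \<le> k" "card (nbrs E v) \<le> k" for u v
      using that c by (auto simp: E)
  qed (use h c k n in \<open>auto simp: deg\<close>)
qed

text \<open>Invariance of \<open>B = {2 * c}\<close> leaves \<open>2 * c\<close> unmatched, so
  \<open>c\<close> is mated with \<open>2 * c + 1\<close> and reaches degree \<open>k + 1\<close>.
  The low vertices \<open>2 * c\<close> and \<open>2 * c + 1\<close> are adjacent.\<close>

lemma construction_k_even_n_even:
  fixes k n :: nat
  assumes k: "k = 2 * h + 2" and n: "n = 2 * c + 2"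
    and E: "E = {{0, 2 * c}, {2 * h + 1, 2 * c}, {c, 2 * c},
      {0, 2 * c + 1}, {c, 2 * c + 1}, {2 * c, 2 * c + 1}} \<union> core True c h"
  shows "co_critical k \<lparr>verts = {..<n}, edges = E\<rparr>"
    and "card E = card (core True c h) + 6"
proof -
  let ?s = "id(c := 2 * c + 1, 2 * c + 1 := c)"
  have deg: "card (nbrs E v) = (if v = 0 then n - 1 else if v = 2 * h + 1 then 2 * k
      else if v = 2 * c then 4 else if v = 2 * c + 1 then 3 else if v < n then k + 1 else 0)" for v
    using h c unfolding E k n
    by (simp add: card_nbrs_insert core_edges(4) finite_nbrs_core finite_nbrs_insert card_nbrs_core_all
        doubleton_eq_iff)
  show "card E = card (core True c h) + 6"
    using h c unfolding E by (simp add: core_edges(4) finite_core doubleton_eq_iff)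
  have W: "insert c {2 * c..<n} = {c, 2 * c, 2 * c + 1}" using n by auto
  show "co_critical k \<lparr>verts = {..<n}, edges = E\<rparr>"
  proof (rule co_critical_extension[where ev = True and B = "{2 * c}" and s = ?s], unfold W)
    show "core True c h \<subseteq> E" by (auto simp: E)
    show "E \<subseteq> all_pairs {..<n}"
      using all_pairs_core[of n True] h c n by (auto simp: E all_pairs_def)
    show "{0, v} \<in> E" if "2 * c \<le> v" "v < n" for v
    proof -
      have "v = 2 * c \<or> v = 2 * c + 1" using that n by auto
      then show ?thesis by (auto simp: E)
    qed
    show "{2 * h + 1, v} \<in> E" if "v \<in> {2 * c}" for v
      using that by (auto simp: E)
    show "{v, ?s v} \<in> E" if "v \<in> {c, 2 * c, 2 * c + 1}" "?s v \<noteq> v" for v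
      using that by (auto simp: E insert_commute)
    show "card (nbrs E v) \<le> (if ?s v = v then k else k + 1)" if "v \<in> {c, 2 * c, 2 * c + 1}" for v
      using that h c k n by (auto simp: deg)
    show "{u, v} \<in> E" if "u \<in> {c, 2 * c, 2 * c + 1}" "v \<in> {c, 2 * c, 2 * c + 1}"
      "u < v" "card (nbrs E u) \<le> k" "card (nbrs E v) \<le> k" for u v
    proof -
      have "u \<noteq> c" using that(4) h c k n by (auto simp: deg)
      then have "u = 2 * c \<and> v = 2 * c + 1" using that(1-3) by auto
      then show ?thesis by (elim disjE conjE) (simp_all add: E)
    qed
  qed (use h c k n in \<open>auto simp: deg\<close>)
qed

end

section \<open>Choice of the parameters\<close>

theorem theorem3p2:
  fixes k n :: nat and eps eps_star :: real
  assumes "k \<ge> 3"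
    and "eps_star = real (k mod 2)"
    and "eps = real (n mod 2)"
    and "real n \<ge> 3 * real k + 3 + eps * (2 * eps_star - 1)"
  shows "\<exists>G :: nat ugraph. co_critical k G \<and> card (verts G) = n \<and>
    real (card (edges G)) =
      (if odd k
       then (real k + 2) * real n / 2 - ((2 + eps) * real k - 4 * eps) / 2
       else (real k + 2) * real n / 2 - ((2 - eps) * real k - 2 * (1 - 2 * eps)) / 2)"
proof -
  define h where "h = (k - 1) div 2"
  \<comment> \<open>The core takes \<open>2 * c\<close> of the \<open>n\<close> vertices, leaving
    two or three extra ones for odd \<open>k\<close> and one or two for even
    \<open>k\<close>.\<close>
  define c where "c = (if odd k \<or> even n then (n - 2) div 2 else n div 2)"
  \<comment> \<open>For odd \<open>k\<close> the bounds on \<open>n\<close> amount exactly to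
    \<open>3 * h + 2 \<le> c\<close>; for even \<open>k\<close> they imply it.\<close>
  have bound: "3 * k + 3 \<le> n" if "even n"
  proof -
    have "3 * real k + 3 \<le> real n" using assms(3,4) that by simp
    then show ?thesis by linarith
  qed
  have bound_odd: "3 * k + 4 \<le> n" if "odd n" "odd k"
  proof -
    have "3 * real k + 4 \<le> real n" using assms(2-4) that by (simp add: odd_iff_mod_2_eq_one)
    then show ?thesis by linarith
  qed
  have bound_odd_even: "3 * k + 2 \<le> n" if "odd n" "even k"
  proof -
    have "3 * real k + 2 \<le> real n" using assms(2-4) that by (simp add: odd_iff_mod_2_eq_one)
    then show ?thesis by linarith
  qed
  have h: "1 \<le> h" using assms(1) by (simp add: h_def)
  have core: "real (card (core ev c h)) = real c * (2 * real h + 3 + of_bool ev) - 2 - of_bool ev"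
    if "3 * h + 2 \<le> c" for ev
    using arg_cong[OF card_core[OF h that, of ev], of real]
    by (simp only: of_nat_add of_nat_mult of_nat_of_bool of_nat_numeral)
  consider "odd k" "even n" | "odd k" "odd n" | "even k" "odd n" | "even k" "even n" by blast
  then show ?thesis
  proof cases
    case 1
    then have k: "k = 2 * h + 1" and n: "n = 2 * c + 2" and c: "3 * h + 2 \<le> c"
      using assms(1) bound unfolding h_def c_def by presburger+
    obtain E where G: "co_critical k \<lparr>verts = {..<n}, edges = E\<rparr>" "card E = card (core False c h) + 4"
      using construction_k_odd_n_even[OF h c k n refl] by blast
    have eps: "eps = 0" using 1 assms(3) by (simp add: odd_iff_mod_2_eq_one)
    show ?thesis
      by (intro exI conjI, rule G(1)) (simp_all add: eps G(2) core[OF c] k n field_simps)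
  next
    case 2
    then have k: "k = 2 * h + 1" and n: "n = 2 * c + 3" and c: "3 * h + 2 \<le> c"
      using assms(1) bound_odd unfolding h_def c_def by presburger+
    obtain E where G: "co_critical k \<lparr>verts = {..<n}, edges = E\<rparr>" "card E = card (core False c h) + 7"
      using construction_k_odd_n_odd[OF h c k n refl] by blast
    have eps: "eps = 1" using 2 assms(3) by (simp add: odd_iff_mod_2_eq_one)
    show ?thesis
      by (intro exI conjI, rule G(1)) (simp_all add: eps G(2) core[OF c] k n field_simps)
  next
    case 3
    then have k: "k = 2 * h + 2" and n: "n = 2 * c + 1" and c: "3 * h + 2 \<le> c"
      using assms(1) bound_odd_even unfolding h_def c_def by presburger+
    obtain E where G: "co_critical k \<lparr>verts = {..<n}, edges = E\<rparr>" "card E = card (core True c h) + 3"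
      using construction_k_even_n_odd[OF h c k n refl] by blast
    have eps: "eps = 1" using 3 assms(3) by (simp add: odd_iff_mod_2_eq_one)
    show ?thesis
      by (intro exI conjI, rule G(1)) (simp_all add: eps G(2) core[OF c] k n field_simps)
  next
    case 4
    then have k: "k = 2 * h + 2" and n: "n = 2 * c + 2" and c: "3 * h + 2 \<le> c"
      using assms(1) bound unfolding h_def c_def by presburger+
    obtain E where G: "co_critical k \<lparr>verts = {..<n}, edges = E\<rparr>" "card E = card (core True c h) + 6"
      using construction_k_even_n_even[OF h c k n refl] by blast
    have eps: "eps = 0" using 4 assms(3) by (simp add: odd_iff_mod_2_eq_one)
    show ?thesis
      by (intro exI conjI, rule G(1)) (simp_all add: eps G(2) core[OF c] k n field_simps)
  qed
qed

end
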